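(* Let $\{\mathcal{P}_n\}_{n\ge0}$ be the GCRR polynomials given in the context, let $\alpha_n\in\mathbb{R}\setminus\{0\}$ and $\mathcal{L}_n(x)=\mathcal{P}_n(x)-\alpha_n\mathcal{P}_{n-1}(x)$, $n\ge1$. Denote the zeros of $\mathcal{P}_n$, $\mathcal{P}_{n-1}$ and $\mathcal{L}_n$, each listed in increasing order, by $x_i^{(n)}$ $(1\le i\le n)$, $x_i^{(n-1)}$ $(1\le i\le n-1)$ and $y_i$ $(1\le i\le n)$ respectively. Then the following triple interlacing property holds. (1) If $\alpha_n>0$, then on $\mathbb{R}\setminus[x_n^{(n)},\infty)$ one has $x_i^{(n)}<y_i<x_i^{(n-1)}$ for all $i=1,2,\ldots,n-1$. (2) If $\alpha_n<0$, then on $\mathbb{R}\setminus(-\infty,x_1^{(n)}]$ one has $x_{i-1}^{(n-1)}<y_i<x_i^{(n)}$ for all $i=2,\ldots,n$.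
   Context: Parameters: $\zeta>0$, $\theta\in\mathbb{R}$, $\omega\in\mathbb{R}\setminus\{0\}$. The generalized complementary Romanovski–Routh (GCRR) polynomials are generated by $\mathcal{P}_0(x)=1$, $\mathcal{P}_1(x)=x-\frac{\theta}{\zeta}$ and $$\mathcal{P}_{n+1}(x)=\left(x-\frac{\theta}{\zeta+n}\right)\mathcal{P}_n(x)-\frac{n(2\zeta+n-1)}{4(\zeta+n)(\zeta+n-1)}(x^2+\omega^2)\mathcal{P}_{n-1}(x),\quad n\ge1.$$ It is known that $\mathcal{P}_n$ has degree $n$ with positive leading coefficient, and that its zeros are real and simple and strictly interlace with those of $\mathcal{P}_{n+1}$. The phrase "on $\mathbb{R}\setminus[x_n^{(n)},\infty)$" (respectively "on $\mathbb{R}\setminus(-\infty,x_1^{(n)}]$") means that the inequalities concern the zeros lying in that set. *)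

theory Defs
  imports "HOL-Computational_Algebra.Polynomial" Complex_Main
begin

fun gcrr :: "real \<Rightarrow> real \<Rightarrow> real \<Rightarrow> nat \<Rightarrow> real poly" where
  "gcrr \<zeta> \<theta> \<omega> 0 = 1"
| "gcrr \<zeta> \<theta> \<omega> (Suc 0) = [:- (\<theta> / \<zeta>), 1:]"
| "gcrr \<zeta> \<theta> \<omega> (Suc (Suc m)) =
     (let n = real (Suc m) in
       [:- (\<theta> / (\<zeta> + n)), 1:] * gcrr \<zeta> \<theta> \<omega> (Suc m)
       - smult (n * (2 * \<zeta> + n - 1) / (4 * (\<zeta> + n) * (\<zeta> + n - 1)))
           ([:\<omega>\<^sup>2, 0, 1:] * gcrr \<zeta> \<theta> \<omega> m))"

lemma poly_gcrr_rec:
  assumes "n \<ge> 1"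
  shows "poly (gcrr \<zeta> \<theta> \<omega> (n + 1)) x =
    (x - \<theta> / (\<zeta> + n)) * poly (gcrr \<zeta> \<theta> \<omega> n) x
    - n * (2 * \<zeta> + n - 1) / (4 * (\<zeta> + n) * (\<zeta> + n - 1)) * (x\<^sup>2 + \<omega>\<^sup>2)
      * poly (gcrr \<zeta> \<theta> \<omega> (n - 1)) x"
proof -
  obtain m where "n = Suc m"
    using assms by (cases n) auto
  then show ?thesis
    by (simp add: Let_def power2_eq_square algebra_simps del: of_nat_Suc)
qed

definition gcrr_comb :: "real \<Rightarrow> real \<Rightarrow> real \<Rightarrow> (nat \<Rightarrow> real) \<Rightarrow> nat \<Rightarrow> real poly" where
  "gcrr_comb \<zeta> \<theta> \<omega> \<alpha> n = gcrr \<zeta> \<theta> \<omega> n - smult (\<alpha> n) (gcrr \<zeta> \<theta> \<omega> (n - 1))"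

definition zeros :: "real poly \<Rightarrow> real set" where
  "zeros p = {x. poly p x = 0}"

text \<open>The \<open>i\<close>-th real zero of \<open>p\<close> in increasing order, counted from 1. It is meaningful
  only for nonzero \<open>p\<close> and \<open>1 \<le> i \<le> card (zeros p)\<close>. Multiplicities are ignored, so it lists
  all zeros of \<open>p\<close> exactly when \<open>card (zeros p) = degree p\<close>, i.e. when all zeros are real
  and simple.\<close>

definition zero_at :: "real poly \<Rightarrow> nat \<Rightarrow> real" where
  "zero_at p i = sorted_list_of_set (zeros p) ! (i - 1)"

end

theory Submission
  imports Defs
begin

text \<open>
  Write \<open>P\<^sub>m\<close> for the \<open>m\<close>-th polynomial. The recurrence coefficients form a chain sequence, and
  this gives the ratio \<open>(2\<zeta> + m) / (2(\<zeta> + m))\<close> of the leading coefficients of \<open>P\<^bsub>m+1\<^esub>\<close> and \<open>P\<^sub>m\<close>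
  (\<open>lead_coeff_gcrr_Suc\<close>); hence \<open>P\<^sub>m\<close> has degree \<open>m\<close> and positive leading coefficient.

  At a zero of \<open>P\<^bsub>m+1\<^esub>\<close> the recurrence reduces to
  \<open>P\<^bsub>m+2\<^esub> = - \<beta> (x\<^sup>2 + \<omega>\<^sup>2) P\<^sub>m\<close> with \<open>\<beta> (x\<^sup>2 + \<omega>\<^sup>2) > 0\<close>. So if the zeros of \<open>P\<^sub>m\<close> and
  \<open>P\<^bsub>m+1\<^esub>\<close> interlace, then the signs of \<open>P\<^bsub>m+2\<^esub>\<close> alternate along the zeros of \<open>P\<^bsub>m+1\<^esub>\<close>;
  together with the signs at the two infinities, the intermediate value theorem places one zero of
  \<open>P\<^bsub>m+2\<^esub>\<close> in each of the \<open>m + 2\<close> gaps (\<open>gcrr_interlacing\<close>).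

  Finally, \<open>L = P\<^sub>n - \<alpha> P\<^bsub>n-1\<^esub>\<close> equals \<open>- \<alpha> P\<^bsub>n-1\<^esub>\<close> at the zeros \<open>x\<^sub>i\<close> of \<open>P\<^sub>n\<close> and equals \<open>P\<^sub>n\<close> at
  the zeros \<open>q\<^sub>i\<close> of \<open>P\<^bsub>n-1\<^esub>\<close>, and the signs of both are known from interlacing. If \<open>\<alpha> > 0\<close>, then
  \<open>L\<close> changes sign on every \<open>(x\<^sub>i, q\<^sub>i)\<close> and on \<open>(x\<^sub>n, \<infinity>)\<close>; if \<open>\<alpha> < 0\<close>, it does so on \<open>(-\<infinity>, x\<^sub>1)\<close>
  and on every \<open>(q\<^bsub>i-1\<^esub>, x\<^sub>i)\<close>. Either way these are \<open>n\<close> disjoint intervals, so they contain all the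
  zeros of \<open>L\<close>, one each.
\<close>

section \<open>Real polynomials with only real simple zeros\<close>

text \<open>The numbers \<open>w 0 < w 1 < \<dots>\<close>, up to index \<open>degree p - 1\<close>, are zeros of \<open>p\<close>. If \<open>p\<close> is not the
  zero polynomial, they are then all its zeros. Indices start at 0, so \<open>w i\<close> is
  \<open>zero_at p (Suc i)\<close>.\<close>

definition enum_zeros :: "real poly \<Rightarrow> (nat \<Rightarrow> real) \<Rightarrow> bool" where
  "enum_zeros p w \<longleftrightarrow> strict_mono_on {..<degree p} w \<and> (\<forall>i<degree p. poly p (w i) = 0)"

lemma enum_zeros_root: "enum_zeros p w \<Longrightarrow> i < degree p \<Longrightarrow> poly p (w i) = 0"
  by (simp add: enum_zeros_def)

lemma enum_zeros_less: "enum_zeros p w \<Longrightarrow> i < j \<Longrightarrow> j < degree p \<Longrightarrow> w i < w j"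
  by (auto simp: enum_zeros_def strict_mono_on_def)

lemma enum_zeros_le: "enum_zeros p w \<Longrightarrow> i \<le> j \<Longrightarrow> j < degree p \<Longrightarrow> w i \<le> w j"
  using enum_zeros_less[of p w i j] by (cases "i = j") auto

lemma enum_zeros_inj_on: "enum_zeros p w \<Longrightarrow> inj_on w {..<degree p}"
  by (simp add: enum_zeros_def strict_mono_on_imp_inj_on)

lemma zeros_eq_image:
  assumes "enum_zeros p w" and "p \<noteq> 0"
  shows "zeros p = w ` {..<degree p}"
proof (rule card_seteq[symmetric])
  show "finite (zeros p)"
    using assms(2) by (simp add: zeros_def poly_roots_finite)
  show "w ` {..<degree p} \<subseteq> zeros p"
    using assms(1) by (auto simp: zeros_def enum_zeros_root)
  show "card (zeros p) \<le> card (w ` {..<degree p})"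
    using card_poly_roots_bound[OF assms(2)] enum_zeros_inj_on[OF assms(1)]
    by (simp add: card_image zeros_def)
qed

lemma card_zeros:
  assumes "enum_zeros p w" and "p \<noteq> 0"
  shows "card (zeros p) = degree p"
  using zeros_eq_image[OF assms] enum_zeros_inj_on[OF assms(1)] by (simp add: card_image)

lemma zero_at_Suc:
  assumes "enum_zeros p w" and "p \<noteq> 0" and "i < degree p"
  shows "zero_at p (Suc i) = w i"
proof -
  have sorted: "sorted_wrt (<) (map w [0..<degree p])"
    using assms(1) by (auto simp: sorted_wrt_iff_nth_less enum_zeros_less)
  have "set (map w [0..<degree p]) = zeros p"
    using zeros_eq_image[OF assms(1,2)] by (simp add: atLeast_upt)
  then have "sorted_list_of_set (zeros p) = map w [0..<degree p]"
    using sorted by (metis sorted_list_of_set.idem_if_sorted_distinct strict_sorted_iff)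
  then show ?thesis
    using assms(3) by (simp add: zero_at_def)
qed

lemma poly_eq_prod_zeros:
  assumes "enum_zeros p w" and "p \<noteq> 0"
  shows "poly p x = lead_coeff p * (\<Prod>i<degree p. x - w i)"
proof -
  let ?n = "degree p"
  let ?q = "smult (lead_coeff p) (\<Prod>i<?n. [:- w i, 1:])"
  have deg_prod: "degree (\<Prod>i<?n. [:- w i, 1:]) = ?n"
    by (subst degree_prod_eq_sum_degree) auto
  have deg_q: "degree ?q = ?n"
    using assms(2) by (simp add: deg_prod)
  have lead_q: "lead_coeff ?q = lead_coeff p"
    by (simp add: lead_coeff_smult lead_coeff_prod)
  have "p - ?q = 0"
  proof (rule ccontr)
    assume ne: "p - ?q \<noteq> 0"
    \<comment> \<open>The leading terms cancel, so the difference has too many zeros for its degree.\<close>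
    have "coeff (p - ?q) ?n = 0"
      using lead_q deg_q by simp
    moreover have "degree (p - ?q) \<le> ?n"
      using deg_q by (intro degree_diff_le) auto
    ultimately have "degree (p - ?q) < ?n"
      using ne by (metis le_neq_implies_less leading_coeff_0_iff)
    moreover have "w ` {..<?n} \<subseteq> {x. poly (p - ?q) x = 0}"
      using assms(1) by (auto simp: enum_zeros_root poly_prod)
    then have "card (w ` {..<?n}) \<le> card {x. poly (p - ?q) x = 0}"
      by (rule card_mono[OF poly_roots_finite[OF ne]])
    then have "?n \<le> card {x. poly (p - ?q) x = 0}"
      using enum_zeros_inj_on[OF assms(1)] by (simp only: card_image card_lessThan)
    ultimately show False
      using card_poly_roots_bound[OF ne] by simp
  qed
  then have "poly p x = poly ?q x"
    by simp
  then show ?thesis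
    by (simp add: poly_prod)
qed

text \<open>The sign of \<open>p\<close> at a point is determined by the number \<open>degree p - k\<close> of zeros above it.\<close>

lemma sign_poly_between_zeros:
  assumes enum: "enum_zeros p w" and lead: "lead_coeff p > 0" and k: "k \<le> degree p"
    and below: "\<And>i. i < k \<Longrightarrow> w i < x"
    and above: "\<And>i. k \<le> i \<Longrightarrow> i < degree p \<Longrightarrow> x < w i"
  shows "(-1) ^ (degree p - k) * poly p x > 0"
proof -
  let ?n = "degree p"
  have "p \<noteq> 0"
    using lead by auto
  have "(\<Prod>i<?n. x - w i) = (\<Prod>i\<in>{..<k}. x - w i) * (\<Prod>i\<in>{k..<?n}. x - w i)"
    using k by (subst prod.union_disjoint[symmetric]) (auto intro!: prod.cong)
  also have "(\<Prod>i\<in>{k..<?n}. x - w i) = (\<Prod>i\<in>{k..<?n}. (-1) * (w i - x))"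
    by (intro prod.cong) auto
  also have "\<dots> = (-1) ^ (?n - k) * (\<Prod>i\<in>{k..<?n}. w i - x)"
    by (subst prod.distrib) simp
  finally have "(-1) ^ (?n - k) * poly p x
      = lead_coeff p * ((\<Prod>i\<in>{..<k}. x - w i) * (\<Prod>i\<in>{k..<?n}. w i - x))"
    using poly_eq_prod_zeros[OF enum \<open>p \<noteq> 0\<close>, of x] by simp
  also have "\<dots> > 0"
    using lead below above by (intro mult_pos_pos prod_pos) auto
  finally show ?thesis .
qed

section \<open>Locating zeros by sign changes\<close>

lemma mult_neg_if_signs_alternate:
  fixes a b :: real
  assumes "(-1) ^ k * a > 0" and "(-1) ^ Suc k * b > 0"
  shows "a * b < 0"
  using assms by (cases "even k") (auto simp: mult_neg_pos mult_pos_neg)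

lemma poly_pos_beyond:
  assumes "lead_coeff (p :: real poly) > 0"
  shows "\<exists>x>t. poly p x > 0"
proof -
  obtain N where "\<And>x. x \<ge> N \<Longrightarrow> poly p x \<ge> lead_coeff p"
    using poly_pinfty_gt_lc[OF assms] by auto
  then have "poly p (max N (t + 1)) > 0"
    using assms by (meson less_le_trans max.cobounded1)
  then show ?thesis
    by (intro exI[of _ "max N (t + 1)"]) auto
qed

lemma sign_poly_before:
  assumes "lead_coeff (p :: real poly) > 0"
  shows "\<exists>x<t. (-1) ^ degree p * poly p x > 0"
proof -
  \<comment> \<open>The reflection \<open>x \<mapsto> - x\<close> moves the behaviour at \<open>-\<infinity>\<close> to \<open>\<infinity>\<close>.\<close>
  let ?q = "smult ((-1) ^ degree p) (pcompose p [:0, -1:])"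
  have "lead_coeff ?q = lead_coeff p"
    by (simp add: lead_coeff_comp power_mult_distrib[symmetric])
  then obtain x where "x > - t" "poly ?q x > 0"
    using poly_pos_beyond[of ?q "- t"] assms by auto
  then show ?thesis
    by (intro exI[of _ "- x"]) (auto simp: poly_pcompose)
qed

lemma enum_zeros_from_sign_changes:
  fixes a b :: "nat \<Rightarrow> real"
  assumes less: "\<And>i. i < degree p \<Longrightarrow> a i < b i"
    and ordered: "\<And>i. Suc i < degree p \<Longrightarrow> b i \<le> a (Suc i)"
    and change: "\<And>i. i < degree p \<Longrightarrow> poly p (a i) * poly p (b i) < 0"
  obtains w where "enum_zeros p w" and "\<And>i. i < degree p \<Longrightarrow> a i < w i \<and> w i < b i"
proof -
  have "\<forall>i\<in>{..<degree p}. \<exists>x. a i < x \<and> x < b i \<and> poly p x = 0"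
    using poly_IVT[OF less change] by auto
  then obtain w where w: "\<And>i. i < degree p \<Longrightarrow> a i < w i \<and> w i < b i \<and> poly p (w i) = 0"
    by (metis lessThan_iff)
  have step: "w i < w (Suc i)" if "Suc i < degree p" for i
    using w[of i] w[of "Suc i"] ordered[of i] that by linarith
  have "j < degree p \<longrightarrow> w i < w j" if "i < j" for i j
    using that
  proof (induction rule: less_Suc_induct)
    case (1 i)
    then show ?case using step by simp
  next
    case (2 i j k)
    then show ?case by (metis less_trans)
  qed
  then have "enum_zeros p w"
    using w by (auto simp: enum_zeros_def strict_mono_on_def)
  then show thesis
    using that w by blast
qed

text \<open>Alternating signs at \<open>m\<close> points suffice for degree \<open>m + 1\<close>, since the leading coefficient
  provides a further sign change at either end.\<close>

lemma enum_zeros_from_alternating_signs: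
  fixes t :: "nat \<Rightarrow> real"
  assumes deg: "degree p = Suc m" and lead: "lead_coeff p > 0" and "m \<ge> 1"
    and t: "\<And>i. Suc i < m \<Longrightarrow> t i < t (Suc i)"
    and sign: "\<And>i. i < m \<Longrightarrow> (-1) ^ (m - i) * poly p (t i) > 0"
  obtains w where "enum_zeros p w" and "\<And>i. i < m \<Longrightarrow> w i < t i \<and> t i < w (Suc i)"
proof -
  obtain lo where lo: "lo < t 0" "(-1) ^ Suc m * poly p lo > 0"
    using sign_poly_before[OF lead, of "t 0"] deg by metis
  obtain hi where hi: "hi > t (m - 1)" "poly p hi > 0"
    using poly_pos_beyond[OF lead, of "t (m - 1)"] by blast
  \<comment> \<open>The \<open>m + 2\<close> points \<open>lo < t 0 < \<dots> < t (m - 1) < hi\<close> bound \<open>m + 1\<close> intervals.\<close>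
  define s where "s = (\<lambda>i. if i = 0 then lo else if i \<le> m then t (i - 1) else hi)"
  have s_less: "s i < s (Suc i)" if "i \<le> m" for i
  proof (cases "i = 0")
    case True
    then show ?thesis using lo \<open>m \<ge> 1\<close> by (simp add: s_def)
  next
    case False
    then show ?thesis using t[of "i - 1"] hi that by (cases "i = m") (auto simp: s_def)
  qed
  have s_sign: "(-1) ^ (Suc m - i) * poly p (s i) > 0" if "i \<le> Suc m" for i
  proof (cases i)
    case 0
    then show ?thesis using lo by (simp add: s_def)
  next
    case (Suc j)
    then show ?thesis using sign[of j] hi that by (cases "j < m") (auto simp: s_def)
  qed
  have s_change: "poly p (s i) * poly p (s (Suc i)) < 0" if "i \<le> m" for i
    using mult_neg_if_signs_alternate[of "m - i" "poly p (s (Suc i))" "poly p (s i)"]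
      s_sign[of i] s_sign[of "Suc i"] that
    by (simp add: Suc_diff_le mult.commute)
  obtain w where w: "enum_zeros p w" "\<And>i. i < degree p \<Longrightarrow> s i < w i \<and> w i < s (Suc i)"
    using enum_zeros_from_sign_changes[of p s "\<lambda>i. s (Suc i)"] s_less s_change deg
    by (metis less_Suc_eq_le order_refl)
  have "w i < t i \<and> t i < w (Suc i)" if "i < m" for i
    using w(2)[of i] w(2)[of "Suc i"] that deg by (simp add: s_def)
  then show thesis
    using that w(1) by blast
qed

section \<open>Interlacing zeros\<close>

text \<open>The zeros of \<open>q\<close>, enumerated by \<open>y\<close>, separate those of \<open>p\<close>, enumerated by \<open>x\<close>; both
  polynomials have positive leading coefficient.\<close>

definition interlacing :: "real poly \<Rightarrow> real poly \<Rightarrow> (nat \<Rightarrow> real) \<Rightarrow> (nat \<Rightarrow> real) \<Rightarrow> bool" where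
  "interlacing p q x y \<longleftrightarrow>
     degree p = Suc (degree q) \<and> lead_coeff p > 0 \<and> lead_coeff q > 0
     \<and> enum_zeros p x \<and> enum_zeros q y \<and> (\<forall>i<degree q. x i < y i \<and> y i < x (Suc i))"

lemma interlacing_less:
  assumes "interlacing p q x y" and "j < i" and "i < degree p"
  shows "y j < x i"
proof -
  have "y j < x (Suc j)" "x (Suc j) \<le> x i"
    using assms enum_zeros_le[of p x "Suc j" i] by (auto simp: interlacing_def)
  then show ?thesis by simp
qed

lemma interlacing_greater:
  assumes "interlacing p q x y" and "i \<le> j" and "j < degree q"
  shows "x i < y j"
proof -
  have "x i \<le> x j" "x j < y j"
    using assms enum_zeros_le[of p x i j] by (auto simp: interlacing_def)
  then show ?thesis by simp
qed

lemma interlacing_sign_inner: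
  assumes "interlacing p q x y" and "i < degree p"
  shows "(-1) ^ (degree q - i) * poly q (x i) > 0"
  using assms interlacing_less[OF assms(1)] interlacing_greater[OF assms(1)]
  by (intro sign_poly_between_zeros[of q y]) (auto simp: interlacing_def)

lemma interlacing_sign_outer:
  assumes "interlacing p q x y" and "i < degree q"
  shows "(-1) ^ (degree q - i) * poly p (y i) > 0"
proof -
  have "(-1) ^ (degree p - Suc i) * poly p (y i) > 0"
    using assms interlacing_less[OF assms(1)] interlacing_greater[OF assms(1)]
    by (intro sign_poly_between_zeros[of p x]) (auto simp: interlacing_def)
  then show ?thesis
    using assms by (simp add: interlacing_def)
qed

text \<open>If \<open>q\<close> interlaces \<open>p\<close>, its signs alternate along the zeros of \<open>p\<close>. A polynomial \<open>r\<close> of opposite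
  sign at these zeros alternates as well, so \<open>p\<close> in turn interlaces \<open>r\<close>.\<close>

lemma interlacing_step:
  assumes pq: "interlacing p q x y" and deg: "degree r = Suc (degree p)"
    and lead: "lead_coeff r > 0"
    and opp: "\<And>i. i < degree p \<Longrightarrow> poly r (x i) * poly q (x i) < 0"
  shows "\<exists>w. interlacing r p w x"
proof -
  have x: "enum_zeros p x" and deg_p: "degree p = Suc (degree q)"
    using pq by (auto simp: interlacing_def)
  have sign: "(-1) ^ (degree p - i) * poly r (x i) > 0" if "i < degree p" for i
  proof -
    have "(-1) ^ (degree q - i) * poly q (x i) > 0"
      using interlacing_sign_inner[OF pq that] .
    moreover have "degree p - i = Suc (degree q - i)"
      using that deg_p by auto
    ultimately show ?thesis
      using opp[OF that]
      by (cases "even (degree q - i)") (auto simp: mult_less_0_iff)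
  qed
  obtain w where "enum_zeros r w" "\<And>i. i < degree p \<Longrightarrow> w i < x i \<and> x i < w (Suc i)"
    using enum_zeros_from_alternating_signs[OF deg lead, of x] sign deg_p enum_zeros_less[OF x]
    by auto
  then show ?thesis
    using pq deg lead by (auto simp: interlacing_def)
qed

section \<open>Linear combinations of interlacing polynomials\<close>

lemma interlacing_comb_lead:
  assumes "interlacing p q x y"
  shows "degree (p - smult c q) = Suc (degree q)" and "lead_coeff (p - smult c q) > 0"
proof -
  have "degree (- smult c q) < degree p"
    using assms by (auto simp: interlacing_def intro: le_less_trans[OF degree_smult_le])
  then have "degree (p - smult c q) = degree p" "lead_coeff (p - smult c q) = lead_coeff p"
    using degree_add_eq_left lead_coeff_add_le[of "- smult c q" p] by fastforce+
  then show "degree (p - smult c q) = Suc (degree q)" "lead_coeff (p - smult c q) > 0"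
    using assms unfolding interlacing_def by metis+
qed

lemma interlacing_comb_pos:
  assumes pq: "interlacing p q x y" and "c > 0"
  obtains z where "enum_zeros (p - smult c q) z"
    and "\<And>i. i < degree q \<Longrightarrow> x i < z i \<and> z i < y i"
proof -
  let ?l = "p - smult c q"
  let ?m = "degree q"
  have lead: "lead_coeff ?l > 0" and deg: "degree ?l = Suc ?m"
    using interlacing_comb_lead[OF pq] by blast+
  obtain hi where hi: "hi > x ?m" "poly ?l hi > 0"
    using poly_pos_beyond[OF lead, of "x ?m"] by blast
  define b where "b i = (if i < ?m then y i else hi)" for i
  have at_x: "(-1) ^ Suc (?m - i) * poly ?l (x i) > 0" if "i \<le> ?m" for i
    using interlacing_sign_inner[OF pq, of i] that pq \<open>c > 0\<close>
      mult_pos_pos[of c "(-1) ^ (?m - i) * poly q (x i)"]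
    by (simp add: interlacing_def enum_zeros_root mult.left_commute)
  have at_b: "(-1) ^ (?m - i) * poly ?l (b i) > 0" if "i \<le> ?m" for i
    using interlacing_sign_outer[OF pq, of i] that pq hi
    by (auto simp: interlacing_def enum_zeros_root b_def)
  have change: "poly ?l (x i) * poly ?l (b i) < 0" if "i < degree ?l" for i
    using mult_neg_if_signs_alternate[OF at_b at_x, of i] that deg by (simp add: mult.commute)
  have less: "x i < b i" if "i < degree ?l" for i
    using that deg pq hi by (auto simp: interlacing_def b_def less_Suc_eq)
  have ordered: "b i \<le> x (Suc i)" if "Suc i < degree ?l" for i
    using that deg pq by (auto simp: interlacing_def b_def intro: less_imp_le)
  obtain z where z: "enum_zeros ?l z" "\<And>i. i < degree ?l \<Longrightarrow> x i < z i \<and> z i < b i"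
    using enum_zeros_from_sign_changes[of ?l x b, OF less ordered change] by blast
  have "x i < z i \<and> z i < y i" if "i < ?m" for i
    using z(2)[of i] that deg by (simp add: b_def)
  then show thesis
    using that z(1) by blast
qed

lemma interlacing_comb_neg:
  assumes pq: "interlacing p q x y" and "c < 0"
  obtains z where "enum_zeros (p - smult c q) z"
    and "\<And>i. i < degree q \<Longrightarrow> y i < z (Suc i) \<and> z (Suc i) < x (Suc i)"
proof -
  let ?l = "p - smult c q"
  let ?m = "degree q"
  have lead: "lead_coeff ?l > 0" and deg: "degree ?l = Suc ?m"
    using interlacing_comb_lead[OF pq] by blast+
  obtain lo where lo: "lo < x 0" "(-1) ^ Suc ?m * poly ?l lo > 0"
    using sign_poly_before[OF lead, of "x 0"] deg by metis
  define a where "a i = (if i = 0 then lo else y (i - 1))" for i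
  have at_x: "(-1) ^ (?m - i) * poly ?l (x i) > 0" if "i \<le> ?m" for i
    using interlacing_sign_inner[OF pq, of i] that pq \<open>c < 0\<close>
      mult_pos_pos[of "- c" "(-1) ^ (?m - i) * poly q (x i)"]
    by (simp add: interlacing_def enum_zeros_root mult.left_commute)
  have at_a: "(-1) ^ Suc (?m - i) * poly ?l (a i) > 0" if "i \<le> ?m" for i
  proof (cases i)
    case 0
    then show ?thesis using lo by (simp add: a_def)
  next
    case (Suc j)
    then have "?m - j = Suc (?m - i)"
      using that by simp
    then show ?thesis
      using interlacing_sign_outer[OF pq, of j] that pq Suc
      by (simp add: interlacing_def enum_zeros_root a_def)
  qed
  have change: "poly ?l (a i) * poly ?l (x i) < 0" if "i < degree ?l" for i
    using mult_neg_if_signs_alternate[OF at_x at_a, of i] that deg by (simp add: mult.commute)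
  have less: "a i < x i" if "i < degree ?l" for i
    using that deg pq lo by (cases i) (auto simp: interlacing_def a_def)
  have ordered: "x i \<le> a (Suc i)" if "Suc i < degree ?l" for i
    using that deg pq by (auto simp: interlacing_def a_def intro: less_imp_le)
  obtain z where z: "enum_zeros ?l z" "\<And>i. i < degree ?l \<Longrightarrow> a i < z i \<and> z i < x i"
    using enum_zeros_from_sign_changes[of ?l a x, OF less ordered change] by blast
  have "y i < z (Suc i) \<and> z (Suc i) < x (Suc i)" if "i < ?m" for i
    using z(2)[of "Suc i"] that deg by (simp add: a_def)
  then show thesis
    using that z(1) by blast
qed

section \<open>The polynomials generated by the recurrence\<close>

lemma degree_gcrr_le: "degree (gcrr \<zeta> \<theta> \<omega> n) \<le> n"
proof (induction \<zeta> \<theta> \<omega> n rule: gcrr.induct)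
  case (3 \<zeta> \<theta> \<omega> m)
  have "degree ([:- (\<theta> / (\<zeta> + real (Suc m))), 1:] * gcrr \<zeta> \<theta> \<omega> (Suc m)) \<le> Suc (Suc m)"
    by (rule order_trans[OF degree_mult_le]) (use 3 in auto)
  moreover have "degree (smult d ([:\<omega>\<^sup>2, 0, 1:] * gcrr \<zeta> \<theta> \<omega> m)) \<le> Suc (Suc m)" for d
    by (rule order_trans[OF degree_smult_le], rule order_trans[OF degree_mult_le])
      (use 3 in auto)
  ultimately show ?case
    unfolding gcrr.simps Let_def by (rule degree_diff_le)
qed auto

text \<open>With \<open>m\<^sub>k = k / (2(\<zeta> + k))\<close> the coefficient of \<open>x\<^sup>2 + \<omega>\<^sup>2\<close> in the recurrence is
  \<open>(1 - m\<^bsub>k-1\<^esub>) m\<^sub>k\<close>. Since \<open>m\<^sub>0 = 0\<close>, induction shows that the leading coefficient is multiplied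
  by \<open>1 - m\<^sub>k\<close> in the step from \<open>k\<close> to \<open>k + 1\<close>.\<close>

lemma lead_coeff_gcrr_Suc:
  assumes "\<zeta> > 0"
  shows "coeff (gcrr \<zeta> \<theta> \<omega> (Suc n)) (Suc n)
    = (2 * \<zeta> + n) / (2 * (\<zeta> + n)) * coeff (gcrr \<zeta> \<theta> \<omega> n) n"
proof (induction n)
  case 0
  then show ?case using assms by simp
next
  case (Suc n)
  let ?P = "\<lambda>k. gcrr \<zeta> \<theta> \<omega> k"
  let ?d = "real (Suc n) * (2 * \<zeta> + real (Suc n) - 1)
    / (4 * (\<zeta> + real (Suc n)) * (\<zeta> + real (Suc n) - 1))"
  have "coeff (?P (Suc n)) (Suc (Suc n)) = 0" "coeff (?P n) (Suc (Suc n)) = 0"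
    by (intro coeff_eq_0 le_less_trans[OF degree_gcrr_le]; simp)+
  then have "coeff (?P (Suc (Suc n))) (Suc (Suc n)) = coeff (?P (Suc n)) (Suc n)
      - ?d * coeff (?P n) n"
    by (simp add: Let_def del: of_nat_Suc)
  also have "?d * coeff (?P n) n = Suc n / (2 * (\<zeta> + Suc n)) * coeff (?P (Suc n)) (Suc n)"
    unfolding Suc.IH using assms by (simp add: divide_simps) (simp add: algebra_simps)
  also have "coeff (?P (Suc n)) (Suc n) - \<dots>
      = (1 - Suc n / (2 * (\<zeta> + Suc n))) * coeff (?P (Suc n)) (Suc n)"
    by (simp add: left_diff_distrib)
  also have "1 - Suc n / (2 * (\<zeta> + Suc n)) = (2 * \<zeta> + Suc n) / (2 * (\<zeta> + Suc n))"
    using assms by (simp add: field_simps)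
  finally show ?case .
qed

lemma coeff_gcrr_pos:
  assumes "\<zeta> > 0"
  shows "coeff (gcrr \<zeta> \<theta> \<omega> n) n > 0"
proof (induction n)
  case (Suc n)
  have "(2 * \<zeta> + n) / (2 * (\<zeta> + n)) > 0"
    using assms by simp
  then show ?case
    unfolding lead_coeff_gcrr_Suc[OF assms] using Suc by (rule mult_pos_pos)
qed simp

lemma degree_gcrr: "\<zeta> > 0 \<Longrightarrow> degree (gcrr \<zeta> \<theta> \<omega> n) = n"
  using coeff_gcrr_pos[of \<zeta> \<theta> \<omega> n] by (intro antisym[OF degree_gcrr_le] le_degree) simp

lemma gcrr_interlacing:
  assumes "\<zeta> > 0" and "\<omega> \<noteq> 0"
  shows "\<exists>x y. interlacing (gcrr \<zeta> \<theta> \<omega> (Suc n)) (gcrr \<zeta> \<theta> \<omega> n) x y"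
proof (induction n)
  case 0
  have "interlacing (gcrr \<zeta> \<theta> \<omega> (Suc 0)) (gcrr \<zeta> \<theta> \<omega> 0) (\<lambda>_. \<theta> / \<zeta>) (\<lambda>_. 0)"
    by (auto simp: interlacing_def enum_zeros_def strict_mono_on_def)
  then show ?case by blast
next
  case (Suc n)
  let ?P = "\<lambda>k. gcrr \<zeta> \<theta> \<omega> k"
  obtain x y where xy: "interlacing (?P (Suc n)) (?P n) x y"
    using Suc by blast
  have "poly (?P (Suc (Suc n))) (x i) * poly (?P n) (x i) < 0" if "i < Suc n" for i
  proof -
    define d where "d = real (Suc n) * (2 * \<zeta> + real (Suc n) - 1)
      / (4 * (\<zeta> + real (Suc n)) * (\<zeta> + real (Suc n) - 1)) * ((x i)\<^sup>2 + \<omega>\<^sup>2)"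
    have "d > 0"
      unfolding d_def using assms by (intro mult_pos_pos divide_pos_pos add_nonneg_pos) auto
    have "poly (?P (Suc n)) (x i) = 0"
      using xy that by (simp add: interlacing_def enum_zeros_root degree_gcrr assms)
    then have "poly (?P (Suc (Suc n))) (x i) = - (d * poly (?P n) (x i))"
      using poly_gcrr_rec[of "Suc n" \<zeta> \<theta> \<omega> "x i"]
      by (simp add: d_def del: of_nat_Suc gcrr.simps)
    moreover have "poly (?P n) (x i) \<noteq> 0"
      using interlacing_sign_inner[OF xy, of i] that by (auto simp: degree_gcrr assms)
    ultimately show ?thesis
      using \<open>d > 0\<close>
      by (auto simp: mult.assoc zero_less_mult_iff linorder_neq_iff simp del: gcrr.simps)
  qed
  then have "\<exists>w. interlacing (?P (Suc (Suc n))) (?P (Suc n)) w x"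
    using coeff_gcrr_pos[OF assms(1), of \<theta> \<omega> "Suc (Suc n)"]
    by (intro interlacing_step[OF xy]) (simp_all add: degree_gcrr assms del: gcrr.simps)
  then show ?case by blast
qed

section \<open>Triple interlacing\<close>

theorem theorem4p4:
  fixes \<zeta> \<theta> \<omega> :: real and \<alpha> :: "nat \<Rightarrow> real" and n :: nat
  assumes "\<zeta> > 0" and "\<omega> \<noteq> 0"
    and "\<And>k. k \<ge> 1 \<Longrightarrow> \<alpha> k \<noteq> 0"
    and "n \<ge> 1"
  defines "P \<equiv> gcrr \<zeta> \<theta> \<omega> n" and "Q \<equiv> gcrr \<zeta> \<theta> \<omega> (n - 1)"
    and "L \<equiv> gcrr_comb \<zeta> \<theta> \<omega> \<alpha> n"
  shows "degree P = n \<and> card (zeros P) = n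
    \<and> degree Q = n - 1 \<and> card (zeros Q) = n - 1
    \<and> degree L = n \<and> card (zeros L) = n
    \<and> (\<alpha> n > 0 \<longrightarrow> (\<forall>i\<in>{1..n - 1}.
          {zero_at P i, zero_at L i, zero_at Q i} \<subseteq> UNIV - {zero_at P n..}
          \<and> zero_at P i < zero_at L i \<and> zero_at L i < zero_at Q i))
    \<and> (\<alpha> n < 0 \<longrightarrow> (\<forall>i\<in>{2..n}.
          {zero_at Q (i - 1), zero_at L i, zero_at P i} \<subseteq> UNIV - {..zero_at P 1}
          \<and> zero_at Q (i - 1) < zero_at L i \<and> zero_at L i < zero_at P i))"
proof -
  obtain m where n: "n = Suc m"
    using \<open>n \<ge> 1\<close> by (cases n) auto
  obtain x y where xy: "interlacing P Q x y"
    using gcrr_interlacing[OF assms(1,2), of \<theta> m] by (auto simp: P_def Q_def n)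
  have L: "L = P - smult (\<alpha> n) Q"
    by (simp add: L_def P_def Q_def gcrr_comb_def)
  have deg: "degree P = Suc m" "degree Q = m" "degree L = Suc m"
    using interlacing_comb_lead(1)[OF xy, of "\<alpha> n"]
    by (simp_all add: P_def Q_def L n degree_gcrr assms(1) del: gcrr.simps)
  have "lead_coeff P > 0" "lead_coeff Q > 0" "lead_coeff L > 0"
    using xy interlacing_comb_lead(2)[OF xy, of "\<alpha> n"] unfolding interlacing_def L by blast+
  then have nz: "P \<noteq> 0" "Q \<noteq> 0" "L \<noteq> 0"
    by auto
  have x: "enum_zeros P x" and y: "enum_zeros Q y"
    and between: "\<And>i. i < m \<Longrightarrow> x i < y i \<and> y i < x (Suc i)"
    using xy deg by (auto simp: interlacing_def)
  note zP = zero_at_Suc[OF x nz(1), unfolded deg] and zQ = zero_at_Suc[OF y nz(2), unfolded deg]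
  have card_PQ: "card (zeros P) = n" "card (zeros Q) = n - 1"
    using card_zeros[OF x nz(1)] card_zeros[OF y nz(2)] deg n by simp_all
  have "\<alpha> n \<noteq> 0"
    using assms(3,4) by blast
  then consider (pos) "\<alpha> n > 0" | (neg) "\<alpha> n < 0"
    by linarith
  then show ?thesis
  proof cases
    case pos
    obtain z where z: "enum_zeros L z" and zb: "\<And>i. i < m \<Longrightarrow> x i < z i \<and> z i < y i"
      using interlacing_comb_pos[OF xy pos] deg by (auto simp: L)
    note zL = zero_at_Suc[OF z nz(3), unfolded deg]
    have "{zero_at P i, zero_at L i, zero_at Q i} \<subseteq> UNIV - {zero_at P n..}
        \<and> zero_at P i < zero_at L i \<and> zero_at L i < zero_at Q i" if i: "i \<in> {1..n - 1}" for i
    proof -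
      obtain j where j: "i = Suc j" "j < m"
        using i n by (cases i) auto
      have "y j < x m"
        using interlacing_less[OF xy, of j m] j deg by simp
      then show ?thesis
        using zb[OF j(2)] j n zP zQ zL by auto
    qed
    then show ?thesis
      using pos card_PQ card_zeros[OF z nz(3)] deg n by simp
  next
    case neg
    obtain z where z: "enum_zeros L z"
      and zb: "\<And>i. i < m \<Longrightarrow> y i < z (Suc i) \<and> z (Suc i) < x (Suc i)"
      using interlacing_comb_neg[OF xy neg] deg by (auto simp: L)
    note zL = zero_at_Suc[OF z nz(3), unfolded deg]
    have "{zero_at Q (i - 1), zero_at L i, zero_at P i} \<subseteq> UNIV - {..zero_at P 1}
        \<and> zero_at Q (i - 1) < zero_at L i \<and> zero_at L i < zero_at P i" if i: "i \<in> {2..n}" for i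
    proof -
      obtain j where j: "i = Suc (Suc j)" "j < m"
        using i n by (cases i; cases "i - 1") auto
      have "x 0 < y j"
        using interlacing_greater[OF xy, of 0 j] j deg by simp
      then show ?thesis
        using zb[OF j(2)] j n zP[of 0] zP[of "Suc j"] zQ[of j] zL[of "Suc j"] by auto
    qed
    then show ?thesis
      using neg card_PQ card_zeros[OF z nz(3)] deg n by simp
  qed
qed

end
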